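(* There exist constants $a>0$, $C>0$ and $\epsilon_0>0$ such that for every $0<\epsilon<\epsilon_0$ and every integer $n\ge 1$: if the $2n$-component link type $H^n$ (the split union of $n$ Hopf links) has a diagonal-$\epsilon$-embedding into the unit cube $I^3=[0,1]^3$, then $n\le C e^{a\epsilon^{-3}}$. (That is, $n(\epsilon)=O(e^{a\epsilon^{-3}})$ for some $a>0$.)
   Context: Links are smooth embedded disjoint unions of circles in $\mathbb{R}^3$. $H^n$ denotes the $2n$-component link type $H_1\sqcup\cdots\sqcup H_n$, where each $H_j=r_j\cup b_j$ is a Hopf link and each $H_j$ is separated from the others by a smoothly embedded 2-sphere (i.e. $H^n$ is the split union of $n$ Hopf links). A diagonal-$\epsilon$-embedding of $H^n$ into the unit cube is a link of type $H^n$ contained in $I^3$ such that $\operatorname{dist}(r_j,b_j)\ge\epsilon$ for all $1\le j\le n$, where $\operatorname{dist}(X,Y)=\inf\{|x-y| : x\in X, y\in Y\}$ is Euclidean distance; no distance condition is imposed between components with different indices $j$. The $O$-notation refers to the regime of sufficiently large $\epsilon^{-1}$. *)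

theory Defs
  imports "HOL-Analysis.Analysis"
begin

primrec Ck_on :: "nat \<Rightarrow> 'a::euclidean_space set \<Rightarrow> ('a \<Rightarrow> 'b::real_normed_vector) \<Rightarrow> bool" where
  "Ck_on 0 U f \<longleftrightarrow> continuous_on U f"
| "Ck_on (Suc k) U f \<longleftrightarrow>
     (\<forall>x\<in>U. f differentiable (at x)) \<and> (\<forall>v. Ck_on k U (\<lambda>x. frechet_derivative f (at x) v))"

(* Ck_on uses the unrestricted filter "at x", so it is meant for open U only. *)
definition smooth_on :: "'a::euclidean_space set \<Rightarrow> ('a \<Rightarrow> 'b::real_normed_vector) \<Rightarrow> bool" where
  "smooth_on U f \<longleftrightarrow> open U \<and> (\<forall>k. Ck_on k U f)"

(* A smooth map on the unit sphere is one that extends smoothly to an open neighbourhood;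
   the tangent space of the sphere at x is the orthogonal complement of x.  Since the sphere is
   compact, an injective immersion is an embedding. *)
definition smooth_sphere_embedding :: "('a::euclidean_space \<Rightarrow> 'b::euclidean_space) \<Rightarrow> bool" where
  "smooth_sphere_embedding f \<longleftrightarrow>
     (\<exists>U. sphere 0 1 \<subseteq> U \<and> smooth_on U f) \<and>
     inj_on f (sphere 0 1) \<and>
     (\<forall>x\<in>sphere 0 1. \<forall>v. v \<bullet> x = 0 \<and> frechet_derivative f (at x) v = 0 \<longrightarrow> v = 0)"

definition smooth_circle :: "(real^3) set \<Rightarrow> bool" where
  "smooth_circle K \<longleftrightarrow>
     (\<exists>f :: real^2 \<Rightarrow> real^3. smooth_sphere_embedding f \<and> K = f ` sphere 0 1)"

definition smooth_2sphere :: "(real^3) set \<Rightarrow> bool" where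
  "smooth_2sphere S \<longleftrightarrow>
     (\<exists>f :: real^3 \<Rightarrow> real^3. smooth_sphere_embedding f \<and> S = f ` sphere 0 1)"

definition diffeomorphism :: "(real^3 \<Rightarrow> real^3) \<Rightarrow> bool" where
  "diffeomorphism f \<longleftrightarrow> bij f \<and> smooth_on UNIV f \<and> smooth_on UNIV (inv f)"

(* Smoothness in time on all of the real line rather than on [0,1] is no restriction,
   by reparametrising an isotopy to be constant in time near and outside the ends. *)
definition smoothly_isotopic :: "(real^3) set \<Rightarrow> (real^3) set \<Rightarrow> bool" where
  "smoothly_isotopic L L' \<longleftrightarrow>
     (\<exists>\<Phi> :: real \<times> (real^3) \<Rightarrow> real^3.
        smooth_on UNIV \<Phi> \<and>
        (\<forall>t\<in>{0..1}. diffeomorphism (\<lambda>x. \<Phi> (t, x))) \<and>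
        (\<forall>x. \<Phi> (0, x) = x) \<and>
        (\<lambda>x. \<Phi> (1, x)) ` L = L')"

(* Two unit circles in perpendicular planes, each through the centre of the other. *)
definition standard_hopf_link :: "(real^3) set" where
  "standard_hopf_link =
     {x. (x$1)\<^sup>2 + (x$2)\<^sup>2 = 1 \<and> x$3 = 0} \<union> {x. (x$1 - 1)\<^sup>2 + (x$3)\<^sup>2 = 1 \<and> x$2 = 0}"

(* Links are unoriented; the unoriented Hopf link is isotopic to its mirror image, and its two
   components are exchanged by an isotopy, so one standard model suffices. *)
definition hopf_link :: "(real^3) set \<Rightarrow> bool" where
  "hopf_link L \<longleftrightarrow> smoothly_isotopic standard_hopf_link L"

definition sphere_separates :: "(real^3) set \<Rightarrow> (real^3) set \<Rightarrow> (real^3) set \<Rightarrow> bool" where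
  "sphere_separates S A B \<longleftrightarrow> smooth_2sphere S \<and>
     (\<exists>U\<in>components (- S). \<exists>V\<in>components (- S). U \<noteq> V \<and> A \<subseteq> U \<and> B \<subseteq> V)"

(* The link with components r 1, b 1, ..., r n, b n is of type H^n. *)
definition split_hopf_link :: "nat \<Rightarrow> (nat \<Rightarrow> (real^3) set) \<Rightarrow> (nat \<Rightarrow> (real^3) set) \<Rightarrow> bool" where
  "split_hopf_link n r b \<longleftrightarrow>
     (\<forall>j\<in>{1..n}. smooth_circle (r j) \<and> smooth_circle (b j) \<and> r j \<inter> b j = {}) \<and>
     (\<forall>i\<in>{1..n}. \<forall>j\<in>{1..n}. i \<noteq> j \<longrightarrow> (r i \<union> b i) \<inter> (r j \<union> b j) = {}) \<and>
     (\<forall>j\<in>{1..n}. hopf_link (r j \<union> b j)) \<and>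
     (\<forall>j\<in>{1..n}. \<exists>S. sphere_separates S (r j \<union> b j) (\<Union>i\<in>{1..n} - {j}. r i \<union> b i))"

definition has_diagonal_embedding :: "nat \<Rightarrow> real \<Rightarrow> bool" where
  "has_diagonal_embedding n \<epsilon> \<longleftrightarrow>
     (\<exists>r b. split_hopf_link n r b \<and>
        (\<forall>j\<in>{1..n}. r j \<union> b j \<subseteq> {x. \<forall>i. 0 \<le> x$i \<and> x$i \<le> 1}) \<and>
        (\<forall>j\<in>{1..n}. setdist (r j) (b j) \<ge> \<epsilon>))"

end

theory Submission
  imports Defs
begin

text \<open>
  Each pair \<open>(r\<^sub>j, b\<^sub>j)\<close> is the image of the standard Hopf link under a homeomorphism of space, which
  turns \<open>x \<mapsto> |x|\<^sup>2 - 1 + 2 \<i> x\<^sub>3\<close> into a map \<open>F\<^sub>j\<close> to the complex plane that vanishes only on \<open>r\<^sub>j\<close>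
  and winds once around 0 along \<open>b\<^sub>j\<close>.  Linking modulo 2 is detected by continuous square roots:
  \<open>F\<^sub>j\<close> has none on \<open>b\<^sub>j\<close>, but it has one on \<open>b\<^sub>i\<close> for \<open>i \<noteq> j\<close>, because a separating sphere is simply
  connected and so \<open>F\<^sub>j\<close> can be modified on the side of \<open>r\<^sub>j\<close> to a nowhere vanishing function on
  all of space.  Now cut the unit cube into about \<open>\<epsilon>\<^sup>-\<^sup>3\<close> cells of diameter less than \<open>\<epsilon>\<close>.  Record the
  set of cells that meet \<open>b\<^sub>j\<close>, and the signs by which chosen square roots of \<open>F\<^sub>j\<close> on these cells
  differ on overlaps.  If \<open>i\<close> and \<open>j\<close> have the same record, then the local square roots of
  \<open>F\<^sub>i F\<^sub>j\<close> fit together, so \<open>F\<^sub>i\<close> would have a square root on \<open>b\<^sub>i\<close>.  Hence \<open>n\<close> is at most the number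
  of records.
\<close>

section \<open>Continuous square roots\<close>

text \<open>For \<open>f\<close> without zeros on a circle this says that its winding number is
  even; it stands in for homology modulo 2.\<close>

definition has_sqrt_on :: "'a::topological_space set \<Rightarrow> ('a \<Rightarrow> complex) \<Rightarrow> bool" where
  "has_sqrt_on S f \<longleftrightarrow> (\<exists>s. continuous_on S s \<and> (\<forall>x\<in>S. (s x)\<^sup>2 = f x))"

lemma has_sqrt_on_subset: "has_sqrt_on S f \<Longrightarrow> T \<subseteq> S \<Longrightarrow> has_sqrt_on T f"
  unfolding has_sqrt_on_def by (meson continuous_on_subset subsetD)

lemma has_sqrt_on_cong: "(\<And>x. x \<in> S \<Longrightarrow> f x = g x) \<Longrightarrow> has_sqrt_on S f \<longleftrightarrow> has_sqrt_on S g"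
  unfolding has_sqrt_on_def by auto

lemma has_sqrt_on_compose:
  assumes "has_sqrt_on T f" "continuous_on S g" "g ` S \<subseteq> T"
  shows "has_sqrt_on S (\<lambda>x. f (g x))"
proof -
  obtain s where s: "continuous_on T s" "\<forall>x\<in>T. (s x)\<^sup>2 = f x"
    using assms(1) unfolding has_sqrt_on_def by blast
  have "continuous_on S (\<lambda>x. s (g x))"
    using continuous_on_compose2[OF s(1) assms(2,3)] .
  with s(2) assms(3) show ?thesis
    unfolding has_sqrt_on_def by blast
qed

lemma has_sqrt_on_mult_cancel:
  assumes "has_sqrt_on S (\<lambda>x. f x * g x)" "has_sqrt_on S g" "\<And>x. x \<in> S \<Longrightarrow> g x \<noteq> 0"
  shows "has_sqrt_on S f"
proof -
  obtain s t where s: "continuous_on S s" "\<forall>x\<in>S. (s x)\<^sup>2 = f x * g x"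
    and t: "continuous_on S t" "\<forall>x\<in>S. (t x)\<^sup>2 = g x"
    using assms(1,2) unfolding has_sqrt_on_def by blast
  have "t x \<noteq> 0" if "x \<in> S" for x
    using t(2) assms(3) that by force
  then have "continuous_on S (\<lambda>x. s x / t x)"
    using s(1) t(1) by (intro continuous_intros) auto
  moreover have "\<forall>x\<in>S. (s x / t x)\<^sup>2 = f x"
    using s(2) t(2) assms(3) by (simp add: power_divide)
  ultimately show ?thesis
    unfolding has_sqrt_on_def by blast
qed

text \<open>Along \<open>cis t\<close> a root \<open>s\<close> differs from the half-angle root
  \<open>cis (t / 2)\<close> by a continuous, hence constant, sign. After a full turn
  \<open>s\<close> is back at its value, but the half-angle root is negated.\<close>

lemma not_has_sqrt_on_circle: "\<not> has_sqrt_on (sphere 0 1) (\<lambda>u::complex. u)"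
proof
  assume "has_sqrt_on (sphere 0 1) (\<lambda>u::complex. u)"
  then obtain s where s: "continuous_on (sphere 0 1) s" "\<And>u::complex. norm u = 1 \<Longrightarrow> (s u)\<^sup>2 = u"
    unfolding has_sqrt_on_def by auto
  define p where "p t = s (cis t) / cis (t / 2)" for t :: real
  have "continuous_on {0..2*pi} (\<lambda>t. s (cis t))"
    by (rule continuous_on_compose2[OF s(1)]) (auto simp: cis_conv_exp intro!: continuous_intros)
  then have "continuous_on {0..2*pi} p"
    unfolding p_def by (intro continuous_intros) (auto simp: cis_conv_exp intro!: continuous_intros)
  moreover have "(p t)\<^sup>2 = 1" for t
    using s(2)[of "cis t"] by (simp add: p_def power_divide power2_eq_square cis_mult)
  then have "p ` {0..2*pi} \<subseteq> {1, -1}"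
    by (auto simp: power2_eq_1_iff)
  then have "finite (p ` {0..2*pi})"
    using finite_subset by blast
  ultimately have "p constant_on {0..2*pi}"
    by (intro continuous_finite_range_constant) auto
  then obtain c where "\<And>t. t \<in> {0..2*pi} \<Longrightarrow> p t = c"
    unfolding constant_on_def by blast
  from this[of 0] this[of "2*pi"] have "p 0 = p (2*pi)"
    by simp
  then have "s 1 = 0"
    by (simp add: p_def)
  then show False
    using s(2)[of 1] by simp
qed

text \<open>On the unit circle \<open>1 + 2 * u\<close> is \<open>u\<close> times a function with
  positive real part. The latter has the principal root, so a root of the product would give one of
  \<open>u\<close>.\<close>

lemma not_has_sqrt_on_offset_circle: "\<not> has_sqrt_on (sphere 0 1) (\<lambda>u::complex. 1 + 2 * u)"
proof
  assume *: "has_sqrt_on (sphere 0 1) (\<lambda>u::complex. 1 + 2 * u)"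
  define g where "g u = 2 + inverse u" for u :: complex
  have eq: "u * g u = 1 + 2 * u" if "norm u = 1" for u
  proof -
    have "u \<noteq> 0" using that by auto
    then show ?thesis by (simp add: g_def algebra_simps)
  qed
  have re: "0 < Re (g u)" if "norm u = 1" for u
  proof -
    have "\<bar>Re (inverse u)\<bar> \<le> 1"
      using abs_Re_le_cmod[of "inverse u"] that by (metis inverse_1 norm_inverse)
    then show ?thesis
      by (simp add: g_def del: inverse_complex.sel)
  qed
  have "continuous_on {z. 0 < Re z} csqrt"
    by (intro continuous_at_imp_continuous_on ballI continuous_at_csqrt) (auto simp: complex_nonpos_Reals_iff)
  then have "continuous_on (sphere 0 1) (\<lambda>u. csqrt (g u))"
  proof (rule continuous_on_compose2)
    show "continuous_on (sphere 0 1) g"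
      unfolding g_def by (intro continuous_intros) auto
    show "g ` sphere 0 1 \<subseteq> {z. 0 < Re z}"
      using re by auto
  qed
  then have g: "has_sqrt_on (sphere 0 1) g"
    unfolding has_sqrt_on_def by (metis power2_csqrt)
  have "has_sqrt_on (sphere 0 1) (\<lambda>u. u * g u)"
    using * eq by (subst has_sqrt_on_cong[where g = "\<lambda>u. 1 + 2 * u"]) auto
  then have "has_sqrt_on (sphere 0 1) (\<lambda>u::complex. u)"
    by (rule has_sqrt_on_mult_cancel[OF _ g]) (use re in force)
  then show False
    using not_has_sqrt_on_circle by blast
qed

lemma sqrt_eq_or_neg:
  fixes s t :: "'a::topological_space \<Rightarrow> complex"
  assumes "connected X" "continuous_on X s" "continuous_on X t"
    and sq: "\<And>x. x \<in> X \<Longrightarrow> (s x)\<^sup>2 = (t x)\<^sup>2" and nz: "\<And>x. x \<in> X \<Longrightarrow> t x \<noteq> 0"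
  shows "(\<forall>x\<in>X. s x = t x) \<or> (\<forall>x\<in>X. s x = - t x)"
proof -
  have "continuous_on X (\<lambda>x. s x / t x)"
    using assms by (intro continuous_intros) auto
  moreover have pm: "(\<lambda>x. s x / t x) ` X \<subseteq> {1, -1}"
    using sq nz by (fastforce simp: power2_eq_iff)
  then have "finite ((\<lambda>x. s x / t x) ` X)"
    using finite_subset by blast
  ultimately obtain c where c: "\<And>x. x \<in> X \<Longrightarrow> s x / t x = c"
    using continuous_finite_range_constant[OF assms(1)] unfolding constant_on_def by metis
  show ?thesis
  proof (cases "X = {}")
    case False
    with pm c have "c = 1 \<or> c = -1" by force
    with c nz show ?thesis
      by (metis divide_eq_eq mult_1 mult_minus1)
  qed auto
qed

section \<open>Counting functions by the signs of local square roots\<close>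

text \<open>A Cech cocycle modulo 2: for roots of one nowhere vanishing function on convex cells,
  overlaps are connected, so disagreement at one point means opposite signs on the whole
  overlap.\<close>

definition sign_changes :: "('i \<Rightarrow> 'a set) \<Rightarrow> 'i set \<Rightarrow> ('i \<Rightarrow> 'a \<Rightarrow> complex) \<Rightarrow> ('i \<times> 'i) set" where
  "sign_changes Q N s = {(p, q). p \<in> N \<and> q \<in> N \<and> (\<exists>x \<in> Q p \<inter> Q q. s p x \<noteq> s q x)}"

text \<open>On an overlap both local roots change sign or neither does. So the products
  \<open>s q x * t q x\<close> agree there and glue over the finitely many closed cells.\<close>

lemma has_sqrt_on_mult_if_same_sign_changes:
  fixes Q :: "'i \<Rightarrow> 'a::real_normed_vector set"
  assumes "finite N" and cv: "\<And>q. q \<in> N \<Longrightarrow> convex (Q q)" and cl: "\<And>q. q \<in> N \<Longrightarrow> closed (Q q)"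
    and s: "\<And>q. q \<in> N \<Longrightarrow> continuous_on (Q q) (s q)"
      "\<And>q x. q \<in> N \<Longrightarrow> x \<in> Q q \<Longrightarrow> (s q x)\<^sup>2 = f x"
    and t: "\<And>q. q \<in> N \<Longrightarrow> continuous_on (Q q) (t q)"
      "\<And>q x. q \<in> N \<Longrightarrow> x \<in> Q q \<Longrightarrow> (t q x)\<^sup>2 = g x"
    and nz: "\<And>q x. q \<in> N \<Longrightarrow> x \<in> Q q \<Longrightarrow> f x \<noteq> 0 \<and> g x \<noteq> 0"
    and eq: "sign_changes Q N s = sign_changes Q N t"
  shows "has_sqrt_on (\<Union>q\<in>N. Q q) (\<lambda>x. f x * g x)"
proof -
  have pm: "(if (p, q) \<in> sign_changes Q N u then u p x = - u q x else u p x = u q x)"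
    if u: "\<And>q. q \<in> N \<Longrightarrow> continuous_on (Q q) (u q)"
      "\<And>q x. q \<in> N \<Longrightarrow> x \<in> Q q \<Longrightarrow> (u q x)\<^sup>2 = h x" "\<And>q x. q \<in> N \<Longrightarrow> x \<in> Q q \<Longrightarrow> h x \<noteq> 0"
      and x: "p \<in> N" "q \<in> N" "x \<in> Q p" "x \<in> Q q" for u h p q x
  proof -
    have "(\<forall>x\<in>Q p \<inter> Q q. u p x = u q x) \<or> (\<forall>x\<in>Q p \<inter> Q q. u p x = - u q x)"
    proof (rule sqrt_eq_or_neg)
      show "connected (Q p \<inter> Q q)"
        using cv x by (simp add: convex_Int convex_connected)
      show "continuous_on (Q p \<inter> Q q) (u p)" "continuous_on (Q p \<inter> Q q) (u q)"
        using u(1) x by (meson Int_lower1 Int_lower2 continuous_on_subset)+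
      show "(u p x)\<^sup>2 = (u q x)\<^sup>2" "u q x \<noteq> 0" if "x \<in> Q p \<inter> Q q" for x
        using u x that by force+
    qed
    then show ?thesis
      using x unfolding sign_changes_def by auto
  qed
  have welldef: "s p x * t p x = s q x * t q x"
    if "p \<in> N" "q \<in> N" "x \<in> Q p" "x \<in> Q q" for p q x
    using pm[of s f p q x] pm[of t g p q x] that s t nz eq by (auto split: if_splits)
  \<comment> \<open>\<open>c\<close> picks some cell containing the point; by \<open>welldef\<close>
    the glued value does not depend on the choice.\<close>
  define c where "c x = (SOME q. q \<in> N \<and> x \<in> Q q)" for x
  have c: "c x \<in> N \<and> x \<in> Q (c x)" if "q \<in> N" "x \<in> Q q" for q x
    unfolding c_def by (rule someI[of _ q]) (use that in blast)
  define h where "h x = s (c x) x * t (c x) x" for x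
  have h: "h x = s q x * t q x" if "q \<in> N" "x \<in> Q q" for q x
    unfolding h_def using welldef c that by blast
  have "continuous_on (\<Union>q\<in>N. Q q) h"
  proof (rule continuous_on_closed_Union[OF \<open>finite N\<close> cl])
    show "continuous_on (Q q) h" if "q \<in> N" for q
    proof -
      have "continuous_on (Q q) (\<lambda>x. s q x * t q x)"
        using s(1) t(1) that by (intro continuous_intros) auto
      then show ?thesis
        using h[OF that] by (simp cong: continuous_on_cong)
    qed
  qed
  moreover have "\<forall>x\<in>(\<Union>q\<in>N. Q q). (h x)\<^sup>2 = f x * g x"
    using h s(2) t(2) by (auto simp: power_mult_distrib)
  ultimately show ?thesis
    unfolding has_sqrt_on_def by blast
qed

text \<open>By \<open>diag\<close> and \<open>off\<close> the sets \<open>b i\<close> and the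
  functions \<open>F j\<close> behave like dual bases modulo 2, which forces distinct indices to
  have distinct records.\<close>

lemma card_le_if_sqrt_dual:
  fixes Q :: "'i \<Rightarrow> 'a::real_normed_vector set" and J :: "'j set"
  assumes G: "finite G" "\<And>q. q \<in> G \<Longrightarrow> convex (Q q)" "\<And>q. q \<in> G \<Longrightarrow> closed (Q q)"
    and N: "\<And>j. j \<in> J \<Longrightarrow> N j \<subseteq> G"
    and b: "\<And>j. j \<in> J \<Longrightarrow> b j \<subseteq> (\<Union>q\<in>N j. Q q)"
    and F: "\<And>j. j \<in> J \<Longrightarrow> continuous_on (\<Union>q\<in>N j. Q q) (F j)"
      "\<And>j x. j \<in> J \<Longrightarrow> x \<in> (\<Union>q\<in>N j. Q q) \<Longrightarrow> F j x \<noteq> 0"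
    and diag: "\<And>j. j \<in> J \<Longrightarrow> \<not> has_sqrt_on (b j) (F j)"
    and off: "\<And>i j. i \<in> J \<Longrightarrow> j \<in> J \<Longrightarrow> i \<noteq> j \<Longrightarrow> has_sqrt_on (b i) (F j)"
  shows "card J \<le> 2 ^ (card G + card {(p, q). p \<in> G \<and> q \<in> G \<and> Q p \<inter> Q q \<noteq> {}})"
    (is "_ \<le> 2 ^ (card G + card ?A)")
proof -
  have "\<exists>s. continuous_on (Q q) s \<and> (\<forall>x\<in>Q q. (s x)\<^sup>2 = F j x)" if "j \<in> J" "q \<in> N j" for j q
  proof -
    have "q \<in> G" using N that by blast
    have "continuous_on (Q q) (F j)"
      using F(1)[OF that(1)] by (rule continuous_on_subset) (use that in blast)
    moreover have "contractible (Q q)"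
      using G(2) \<open>q \<in> G\<close> by (simp add: convex_imp_contractible)
    moreover have "\<And>x. x \<in> Q q \<Longrightarrow> F j x \<noteq> 0"
      using F(2) that by blast
    ultimately show ?thesis
      by (metis continuous_sqrt_on_contractible)
  qed
  then obtain s where s: "\<And>j q. j \<in> J \<Longrightarrow> q \<in> N j \<Longrightarrow> continuous_on (Q q) (s j q)"
    "\<And>j q x. j \<in> J \<Longrightarrow> q \<in> N j \<Longrightarrow> x \<in> Q q \<Longrightarrow> (s j q x)\<^sup>2 = F j x"
    by metis
  define D where "D j = (N j, sign_changes Q (N j) (s j))" for j
  have "inj_on D J"
  proof (rule inj_onI, rule ccontr)
    fix i j assume ij: "i \<in> J" "j \<in> J" "D i = D j" "i \<noteq> j"
    then have Neq: "N j = N i" and seq: "sign_changes Q (N i) (s i) = sign_changes Q (N i) (s j)"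
      by (auto simp: D_def)
    have "has_sqrt_on (\<Union>q\<in>N i. Q q) (\<lambda>x. F i x * F j x)"
    proof (rule has_sqrt_on_mult_if_same_sign_changes[OF _ _ _ _ _ _ _ _ seq])
      show "finite (N i)"
        using N[OF ij(1)] G(1) finite_subset by blast
      show "convex (Q q)" "closed (Q q)" if "q \<in> N i" for q
        using G N ij(1) that by blast+
      show "F i x \<noteq> 0 \<and> F j x \<noteq> 0" if "q \<in> N i" "x \<in> Q q" for q x
        using F(2)[OF ij(1)] F(2)[OF ij(2)] that Neq by auto
    qed (use s ij Neq in auto)
    then have "has_sqrt_on (b i) (\<lambda>x. F i x * F j x)"
      using b ij has_sqrt_on_subset by blast
    moreover have "F j x \<noteq> 0" if "x \<in> b i" for x
      using b[OF ij(1)] F(2)[OF ij(2)] that Neq by auto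
    ultimately have "has_sqrt_on (b i) (F i)"
      using has_sqrt_on_mult_cancel off ij by blast
    then show False
      using diag ij by blast
  qed
  have "?A \<subseteq> G \<times> G" by auto
  then have A: "finite ?A"
    using G(1) finite_subset by blast
  \<comment> \<open>Only cells that meet can show a sign change, so the second half of a record is a
    subset of \<open>?A\<close>, not just of \<open>G \<times> G\<close>. This makes an exponent
    linear in the number of cells possible.\<close>
  have "D ` J \<subseteq> Pow G \<times> Pow ?A"
    using N by (fastforce simp: D_def sign_changes_def)
  then have "card (D ` J) \<le> card (Pow G \<times> Pow ?A)"
    using A G(1) by (intro card_mono) auto
  then show ?thesis
    using \<open>inj_on D J\<close> A G(1) by (simp add: card_image card_cartesian_product card_Pow power_add)
qed

section \<open>The grid\<close>

definition grid_cell :: "nat \<Rightarrow> ('n::finite \<Rightarrow> nat) \<Rightarrow> (real^'n) set" where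
  "grid_cell K q = cbox (\<chi> i. real (q i) / real K) (\<chi> i. (real (q i) + 1) / real K)"

lemma mem_grid_cell:
  assumes "K > 0"
  shows "x \<in> grid_cell K q \<longleftrightarrow> (\<forall>i. real (q i) \<le> real K * x$i \<and> real K * x$i \<le> real (q i) + 1)"
  using assms by (simp add: grid_cell_def mem_box_cart field_simps)

text \<open>Each coordinate varies by at most \<open>1 / real K\<close>, and the l1 norm dominates
  the Euclidean one; hence the factor \<open>CARD('n)\<close>.\<close>

lemma dist_grid_cell_le:
  fixes x y :: "real^'n"
  assumes "K > 0" "x \<in> grid_cell K q" "y \<in> grid_cell K q"
  shows "dist x y \<le> real CARD('n) / real K"
proof -
  have "\<bar>(x - y)$i\<bar> \<le> 1 / real K" for i
  proof -
    have "\<bar>real K * x$i - real K * y$i\<bar> \<le> 1"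
      using assms(2,3) unfolding mem_grid_cell[OF assms(1)] by (smt (verit))
    then have "real K * \<bar>(x - y)$i\<bar> \<le> 1"
      by (simp add: right_diff_distrib[symmetric] abs_mult)
    then show ?thesis
      using assms(1) by (simp add: field_simps)
  qed
  then have "(\<Sum>i\<in>UNIV. \<bar>(x - y)$i\<bar>) \<le> real CARD('n) * (1 / real K)"
    by (rule sum_bounded_above)
  then show ?thesis
    using norm_le_l1_cart[of "x - y"] by (simp add: dist_norm)
qed

lemma grid_cells_cover_unit_cube:
  fixes x :: "real^'n"
  assumes "K > 0" "\<forall>i. 0 \<le> x$i \<and> x$i \<le> 1"
  shows "\<exists>q\<in>UNIV \<rightarrow>\<^sub>E {..K}. x \<in> grid_cell K q"
proof
  let ?q = "\<lambda>i. nat \<lfloor>real K * x$i\<rfloor>"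
  have "0 \<le> real K * x$i" "real K * x$i \<le> real K" for i
    using assms by (auto simp: mult_left_le)
  \<comment> \<open>A coordinate equal to 1 gets the index \<open>K\<close>, hence
    \<open>K + 1\<close> cells in each direction.\<close>
  then show "?q \<in> UNIV \<rightarrow>\<^sub>E {..K}"
    by (auto simp: nat_le_iff floor_le_iff) (smt (verit))
  have "real (?q i) \<le> real K * x$i \<and> real K * x$i \<le> real (?q i) + 1" for i
    using \<open>\<And>i. 0 \<le> real K * x$i\<close>[of i] by (simp add: of_nat_nat)
  then show "x \<in> grid_cell K ?q"
    by (simp add: mem_grid_cell[OF assms(1)])
qed

lemma card_grid: "card ((UNIV :: 'n::finite set) \<rightarrow>\<^sub>E {..K::nat}) = (K + 1) ^ CARD('n)"
  by (simp add: card_PiE)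

text \<open>Indices of cells that meet differ by at most 1 in every coordinate, which leaves
  \<open>3 ^ CARD('n)\<close> partners for each cell.\<close>

lemma card_adjacent_grid_cells:
  fixes K :: nat
  assumes "K > 0"
  defines "G \<equiv> (UNIV :: 'n::finite set) \<rightarrow>\<^sub>E {..K}"
  shows "card {(p, q). p \<in> G \<and> q \<in> G \<and> (grid_cell K p :: (real^'n) set) \<inter> grid_cell K q \<noteq> {}}
    \<le> 3 ^ CARD('n) * (K + 1) ^ CARD('n)" (is "card ?A \<le> _")
proof -
  let ?E = "(UNIV :: 'n set) \<rightarrow>\<^sub>E {..2::nat}"
  \<comment> \<open>\<open>d\<close> is the difference \<open>q - p\<close> raised by 1, so that it
    stays in the natural numbers.\<close>
  have "?A \<subseteq> (\<lambda>(p, d). (p, \<lambda>i. p i + d i - 1)) ` (G \<times> ?E)"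
  proof clarify
    fix p q :: "'n \<Rightarrow> nat"
    assume pq: "p \<in> G" "q \<in> G" "(grid_cell K p :: (real^'n) set) \<inter> grid_cell K q \<noteq> {}"
    then obtain x :: "real^'n" where x: "x \<in> grid_cell K p" "x \<in> grid_cell K q"
      by blast
    have close: "q i \<le> p i + 1 \<and> p i \<le> q i + 1" for i
    proof -
      have "real (q i) \<le> real (p i) + 1" "real (p i) \<le> real (q i) + 1"
        using x unfolding mem_grid_cell[OF assms(1)] by (meson order_trans)+
      then show ?thesis by linarith
    qed
    have "q i + 1 - p i \<le> 2" for i
      using close[of i] by linarith
    then have "(\<lambda>i. q i + 1 - p i) \<in> ?E"
      by auto
    moreover have "q = (\<lambda>i. p i + (q i + 1 - p i) - 1)"
    proof
      show "q i = p i + (q i + 1 - p i) - 1" for i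
        using close[of i] by simp
    qed
    ultimately show "(p, q) \<in> (\<lambda>(p, d). (p, \<lambda>i. p i + d i - 1)) ` (G \<times> ?E)"
      using pq(1) by (intro image_eqI[of _ _ "(p, \<lambda>i. q i + 1 - p i)"]) auto
  qed
  moreover have fin: "finite (G \<times> ?E)"
    by (auto simp: G_def intro!: finite_PiE)
  ultimately have "card ?A \<le> card (G \<times> ?E)"
    by (rule surj_card_le[rotated])
  also have "\<dots> = 3 ^ CARD('n) * (K + 1) ^ CARD('n)"
    by (simp add: G_def card_cartesian_product card_grid card_PiE)
  finally show ?thesis .
qed

section \<open>Linking and separation\<close>

definition hopf_red :: "(real^3) set" where
  "hopf_red = {x. (x$1)\<^sup>2 + (x$2)\<^sup>2 = 1 \<and> x$3 = 0}"

definition hopf_blue :: "(real^3) set" where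
  "hopf_blue = {x. (x$1 - 1)\<^sup>2 + (x$3)\<^sup>2 = 1 \<and> x$2 = 0}"

text \<open>Its winding number around 0 along a loop off the red circle is, up to sign, the linking
  number with that circle. The factor 2 turns it into \<open>1 + 2 * u\<close> on the blue
  circle.\<close>

definition hopf_map :: "real^3 \<Rightarrow> complex" where
  "hopf_map x = Complex ((x$1)\<^sup>2 + (x$2)\<^sup>2 + (x$3)\<^sup>2 - 1) (2 * x$3)"

text \<open>An isometric involution exchanging the two circles; it settles the case in which
  \<open>r\<close> comes from the blue one.\<close>

definition hopf_swap :: "real^3 \<Rightarrow> real^3" where
  "hopf_swap x = vector [1 - x$1, x$3, x$2]"

lemma hopf_swap_swap [simp]: "hopf_swap (hopf_swap x) = x"
  by (simp add: hopf_swap_def vec_eq_iff forall_3)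

lemma hopf_swap_mem:
  "hopf_swap x \<in> hopf_red \<longleftrightarrow> x \<in> hopf_blue" "hopf_swap x \<in> hopf_blue \<longleftrightarrow> x \<in> hopf_red"
  by (auto simp: hopf_swap_def hopf_red_def hopf_blue_def power2_commute)

lemma continuous_on_vector_3:
  assumes "continuous_on S f" "continuous_on S g" "continuous_on S h"
  shows "continuous_on S (\<lambda>x. vector [f x, g x, h x] :: real^3)"
proof -
  have eq: "(\<lambda>x. vector [f x, g x, h x] :: real^3) =
      (\<lambda>x. \<chi> i. if i = 1 then f x else if i = 2 then g x else h x)"
    by (auto simp: vec_eq_iff forall_3)
  have "continuous_on S (\<lambda>x. if i = 1 then f x else if i = 2 then g x else h x)" for i :: 3
    using assms by (cases "i = 1"; cases "i = 2") simp_all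
  then show ?thesis
    unfolding eq by (rule continuous_on_vec_lambda)
qed

lemma continuous_on_hopf_swap: "continuous_on S hopf_swap"
  unfolding hopf_swap_def by (intro continuous_on_vector_3 continuous_intros)

lemma continuous_on_hopf_map: "continuous_on S hopf_map"
  unfolding hopf_map_def by (intro continuous_intros)

lemma hopf_map_eq_0_iff: "hopf_map x = 0 \<longleftrightarrow> x \<in> hopf_red"
  by (auto simp: hopf_map_def hopf_red_def complex_eq_iff)

definition blue_param :: "complex \<Rightarrow> real^3" where
  "blue_param u = vector [1 + Re u, 0, Im u]"

lemma continuous_on_blue_param: "continuous_on S blue_param"
  unfolding blue_param_def by (intro continuous_on_vector_3 continuous_intros)

lemma hopf_blue_eq_image: "hopf_blue = blue_param ` sphere 0 1"
proof -
  have "blue_param u \<in> hopf_blue" if "norm u = 1" for u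
    using that cmod_power2[of u] by (simp add: blue_param_def hopf_blue_def)
  moreover have "x \<in> blue_param ` sphere 0 1" if "x \<in> hopf_blue" for x
    using that
    by (intro image_eqI[of _ _ "Complex (x$1 - 1) (x$3)"])
      (auto simp: blue_param_def hopf_blue_def vec_eq_iff forall_3 cmod_def)
  ultimately show ?thesis by auto
qed

lemma hopf_red_eq_image: "hopf_red = hopf_swap ` hopf_blue"
proof
  show "hopf_red \<subseteq> hopf_swap ` hopf_blue"
    using hopf_swap_mem(2) hopf_swap_swap by (metis image_eqI subsetI)
  show "hopf_swap ` hopf_blue \<subseteq> hopf_red"
    using hopf_swap_mem(1) by blast
qed

lemma compact_connected_hopf_blue: "compact hopf_blue" "connected hopf_blue"
  unfolding hopf_blue_eq_image
  by (auto intro!: compact_continuous_image connected_continuous_image continuous_on_blue_param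
      connected_sphere)

lemma compact_connected_hopf_red: "compact hopf_red" "connected hopf_red"
  unfolding hopf_red_eq_image
  by (auto intro!: compact_continuous_image connected_continuous_image continuous_on_hopf_swap
      compact_connected_hopf_blue)

lemma hopf_nonempty: "hopf_red \<noteq> {}" "hopf_blue \<noteq> {}"
  by (simp_all add: hopf_red_eq_image hopf_blue_eq_image)

lemma hopf_disjoint: "hopf_red \<inter> hopf_blue = {}"
proof -
  \<comment> \<open>A common point has \<open>x$2 = x$3 = 0\<close>, so \<open>x$1\<close> and
    \<open>x$1 - 1\<close> would both be 1 or -1.\<close>
  have "a = 1 \<or> a = -1" if "a\<^sup>2 = 1" for a :: real
    using that by (simp add: power2_eq_1_iff)
  then show ?thesis
    by (fastforce simp: hopf_red_def hopf_blue_def)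
qed

lemma not_has_sqrt_on_hopf_blue: "\<not> has_sqrt_on hopf_blue hopf_map"
proof
  assume "has_sqrt_on hopf_blue hopf_map"
  then have "has_sqrt_on (sphere 0 1) (\<lambda>u. hopf_map (blue_param u))"
    by (rule has_sqrt_on_compose) (auto simp: continuous_on_blue_param hopf_blue_eq_image)
  moreover have "hopf_map (blue_param u) = 1 + 2 * u" if "norm u = 1" for u
    using that cmod_power2[of u]
    by (simp add: hopf_map_def blue_param_def complex_eq_iff power2_eq_square algebra_simps)
  ultimately have "has_sqrt_on (sphere 0 1) (\<lambda>u::complex. 1 + 2 * u)"
    by (subst (asm) has_sqrt_on_cong) auto
  then show False
    using not_has_sqrt_on_offset_circle by blast
qed

text \<open>Needed because \<open>hopf_link\<close> sees only the union of the two components. A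
  connected set covered by two disjoint closed sets lies in one of them; applied both ways, this
  matches the pieces up to order.\<close>

lemma connected_pair_eq:
  fixes A B C D :: "'a::topological_space set"
  assumes conn: "connected A" "connected B" "connected C" "connected D"
    and clo: "closed A" "closed B" "closed C" "closed D"
    and ne: "A \<noteq> {}" "B \<noteq> {}" "C \<noteq> {}" "D \<noteq> {}"
    and disj: "A \<inter> B = {}" "C \<inter> D = {}" and un: "A \<union> B = C \<union> D"
  shows "A = C \<and> B = D \<or> A = D \<and> B = C"
proof -
  have one_side: "X \<subseteq> Y \<or> X \<subseteq> Z"
    if "connected X" "X \<subseteq> Y \<union> Z" "closed Y" "closed Z" "Y \<inter> Z = {}" for X Y Z :: "'a set"
    using connected_closedD[OF that(1) _ that(2-4)] that(2,5) by blast
  have "A \<subseteq> C \<or> A \<subseteq> D" "B \<subseteq> C \<or> B \<subseteq> D"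
    using conn clo disj(2) un by (intro one_side; blast)+
  moreover have "C \<subseteq> A \<or> C \<subseteq> B" "D \<subseteq> A \<or> D \<subseteq> B"
    using conn clo disj(1) un by (intro one_side; blast)+
  ultimately show ?thesis
    using ne disj un by blast
qed

section \<open>From smooth circles, spheres and isotopies to topology\<close>

lemma smooth_on_imp_continuous_on:
  assumes "smooth_on U f"
  shows "continuous_on U f"
  using assms unfolding smooth_on_def by (metis Ck_on.simps(1))

lemma smooth_circle_compact_connected:
  assumes "smooth_circle K"
  shows "compact K" "connected K" "K \<noteq> {}"
proof -
  obtain f :: "real^2 \<Rightarrow> real^3" and U where f: "sphere 0 1 \<subseteq> U" "smooth_on U f" "K = f ` sphere 0 1"
    using assms unfolding smooth_circle_def smooth_sphere_embedding_def by blast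
  then have "continuous_on (sphere 0 1) f"
    using smooth_on_imp_continuous_on continuous_on_subset by blast
  then show "compact K" "connected K" "K \<noteq> {}"
    unfolding f(3) by (auto intro!: compact_continuous_image connected_continuous_image connected_sphere)
qed

lemma smooth_2sphere_homeomorphic:
  assumes "smooth_2sphere S"
  shows "S homeomorphic (sphere 0 1 :: (real^3) set)"
proof -
  obtain f :: "real^3 \<Rightarrow> real^3" and U where f: "sphere 0 1 \<subseteq> U" "smooth_on U f" "S = f ` sphere 0 1"
      "inj_on f (sphere 0 1)"
    using assms unfolding smooth_2sphere_def smooth_sphere_embedding_def by blast
  then have "continuous_on (sphere 0 1) f"
    using smooth_on_imp_continuous_on continuous_on_subset by blast
  then have "(sphere 0 1 :: (real^3) set) homeomorphic S"
    using f(3,4) by (intro homeomorphic_compact[of _ f]) auto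
  then show ?thesis
    by (subst homeomorphic_sym)
qed

text \<open>\<open>F\<close> is \<open>hopf_map\<close> composed with the inverse of the
  diffeomorphism that ends the isotopy, followed by \<open>hopf_swap\<close> if the components
  correspond the other way round.\<close>

lemma hopf_link_detecting_map:
  assumes "hopf_link (r \<union> b)" "smooth_circle r" "smooth_circle b" "r \<inter> b = {}"
  obtains F where "continuous_on UNIV F" "\<And>x. x \<notin> r \<Longrightarrow> F x \<noteq> 0" "\<not> has_sqrt_on b F"
proof -
  obtain h where h: "diffeomorphism h" "h ` standard_hopf_link = r \<union> b"
    using assms(1) unfolding hopf_link_def smoothly_isotopic_def by (metis atLeastAtMost_iff order_refl zero_le_one)
  then have bij: "bij h" and conth: "continuous_on UNIV h" and conti: "continuous_on UNIV (inv h)"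
    unfolding diffeomorphism_def using smooth_on_imp_continuous_on by blast+
  have inv_h [simp]: "inv h (h x) = x" "h (inv h x) = x" for x
    using bij by (simp_all add: bij_is_inj bij_is_surj surj_f_inv_f)
  have conth': "continuous_on S h" for S
    using conth continuous_on_subset by blast
  have "standard_hopf_link = hopf_red \<union> hopf_blue"
    by (simp add: standard_hopf_link_def hopf_red_def hopf_blue_def)
  then have un: "r \<union> b = h ` hopf_red \<union> h ` hopf_blue"
    using h(2) by (metis image_Un)
  have disj: "h ` hopf_red \<inter> h ` hopf_blue = {}"
    using hopf_disjoint bij by (metis bij_is_inj image_Int image_empty)
  have "r = h ` hopf_red \<and> b = h ` hopf_blue \<or> r = h ` hopf_blue \<and> b = h ` hopf_red"
    using smooth_circle_compact_connected[OF assms(2)] smooth_circle_compact_connected[OF assms(3)]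
      hopf_nonempty assms(4) disj un
    by (intro connected_pair_eq)
      (auto intro!: compact_imp_closed compact_continuous_image connected_continuous_image conth'
        compact_connected_hopf_red compact_connected_hopf_blue)
  \<comment> \<open>This covers both matchings of the components: \<open>k\<close> carries exactly
    \<open>r\<close> to the red circle, and a root on \<open>b\<close> can be pulled back along the
    right inverse \<open>k'\<close> to the blue circle.\<close>
  then obtain k k' where k: "continuous_on UNIV k" "continuous_on UNIV k'" "\<And>x. k (k' x) = x"
      "\<And>x. k x \<in> hopf_red \<longleftrightarrow> x \<in> r" "k' ` hopf_blue \<subseteq> b"
  proof
    assume *: "r = h ` hopf_red \<and> b = h ` hopf_blue"
    have "inv h x \<in> hopf_red \<longleftrightarrow> x \<in> r" for x
      using * inv_h by (metis image_iff)
    then show ?thesis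
      using that[of "inv h" h] conth conti * by simp
  next
    assume *: "r = h ` hopf_blue \<and> b = h ` hopf_red"
    have "continuous_on UNIV (\<lambda>x. hopf_swap (inv h x))"
      by (rule continuous_on_compose2[OF continuous_on_hopf_swap conti subset_UNIV])
    moreover have "continuous_on UNIV (\<lambda>x. h (hopf_swap x))"
      by (rule continuous_on_compose2[OF conth continuous_on_hopf_swap subset_UNIV])
    moreover have "hopf_swap (inv h x) \<in> hopf_red \<longleftrightarrow> x \<in> r" for x
      using * inv_h by (metis image_iff hopf_swap_mem(1))
    moreover have "(\<lambda>x. h (hopf_swap x)) ` hopf_blue \<subseteq> b"
      using * hopf_red_eq_image by auto
    ultimately show ?thesis
      using that[of "\<lambda>x. hopf_swap (inv h x)" "\<lambda>x. h (hopf_swap x)"] by simp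
  qed
  show thesis
  proof
    show "continuous_on UNIV (\<lambda>x. hopf_map (k x))"
      by (rule continuous_on_compose2[OF continuous_on_hopf_map k(1) subset_UNIV])
    show "hopf_map (k x) \<noteq> 0" if "x \<notin> r" for x
      using that k(4) hopf_map_eq_0_iff by blast
    show "\<not> has_sqrt_on b (\<lambda>x. hopf_map (k x))"
    proof
      assume "has_sqrt_on b (\<lambda>x. hopf_map (k x))"
      then have "has_sqrt_on hopf_blue (\<lambda>x. hopf_map (k (k' x)))"
        by (rule has_sqrt_on_compose[OF _ continuous_on_subset[OF k(2) subset_UNIV] k(5),
              where f = "\<lambda>x. hopf_map (k x)"])
      then show False
        using k(3) not_has_sqrt_on_hopf_blue by simp
    qed
  qed
qed

text \<open>
  The logarithm on the sphere \<open>S\<close> extends over the complement of \<open>V\<close> by Tietze, so \<open>F\<close> restricted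
  to \<open>V\<close> extends to a nowhere vanishing function on the whole contractible space.
\<close>
lemma has_sqrt_on_component_of_sphere_complement:
  fixes S :: "'a::euclidean_space set" and F :: "'a \<Rightarrow> complex"
  assumes S: "S homeomorphic (sphere a r :: 'b::euclidean_space set)" "3 \<le> DIM('b)"
    and V: "V \<in> components (- S)"
    and F: "continuous_on (V \<union> S) F" "\<And>x. x \<in> V \<union> S \<Longrightarrow> F x \<noteq> 0"
  shows "has_sqrt_on V F"
proof -
  have cS: "compact S"
    using S(1) compact_sphere homeomorphic_compactness by blast
  have "open V"
    using V cS by (meson compact_imp_closed open_Compl open_components)
  have VS: "V \<inter> S = {}"
    using V in_components_subset by blast
  have "frontier V \<subseteq> S"
    using V cS by (metis compact_imp_closed frontier_of_components_closed_complement)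
  then have clVS: "closed (V \<union> S)"
    using cS \<open>open V\<close> closure_Un_frontier[of V]
    by (metis (no_types, lifting) closed_Un closed_closure compact_imp_closed sup.absorb2 sup.assoc)
  \<comment> \<open>\<open>3 \<le> DIM('b)\<close> makes the model sphere at least two-dimensional;
    on a circle the logarithm could fail to exist.\<close>
  have "simply_connected S"
    using S homeomorphic_simply_connected_eq simply_connected_sphere by blast
  moreover have "locally path_connected S"
    using homeomorphic_locally[OF S(1), where P = path_connected and Q = path_connected]
      homeomorphic_path_connectedness locally_path_connected_sphere by blast
  ultimately obtain l where l: "continuous_on S l" "\<And>x. x \<in> S \<Longrightarrow> F x = exp (l x)"
    using continuous_logarithm_on_simply_connected[of S F] F continuous_on_subset
    by (metis Un_iff Un_upper2)
  have "closedin (top_of_set UNIV) S"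
    using cS by (simp add: compact_imp_closed)
  then obtain m where m: "continuous_on UNIV m" "\<And>x. x \<in> S \<Longrightarrow> m x = l x"
    using Tietze_unbounded[OF l(1)] by blast
  define H where "H x = (if x \<in> V then F x else exp (m x))" for x
  \<comment> \<open>The closed sets \<open>V \<union> S\<close> and \<open>- V\<close> meet exactly
    in \<open>S\<close>, where both branches equal \<open>exp (l x)\<close>.\<close>
  have "continuous_on ((V \<union> S) \<union> - V) H"
    unfolding H_def
  proof (rule continuous_on_cases[OF clVS _ F(1)])
    show "closed (- V)"
      using \<open>open V\<close> by (rule closed_Compl)
    show "continuous_on (- V) (\<lambda>x. exp (m x))"
      using m(1) continuous_on_subset by (intro continuous_intros) auto
    show "\<forall>x. x \<in> V \<union> S \<and> x \<notin> V \<or> x \<in> - V \<and> x \<in> V \<longrightarrow> F x = exp (m x)"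
      using l(2) m(2) by auto
  qed
  moreover have "(V \<union> S) \<union> - V = UNIV"
    by auto
  ultimately have "continuous_on UNIV H" by simp
  moreover have "H x \<noteq> 0" for x
    using F(2) by (simp add: H_def)
  ultimately have "has_sqrt_on UNIV H"
    unfolding has_sqrt_on_def by (metis continuous_sqrt_on_contractible contractible_UNIV)
  then have "has_sqrt_on V H"
    using has_sqrt_on_subset by blast
  then show ?thesis
    by (subst has_sqrt_on_cong[where g = H]) (auto simp: H_def)
qed

section \<open>The bound\<close>

lemma diagonal_embedding_card_le:
  assumes "has_diagonal_embedding n \<epsilon>" "K > 0" "3 / real K < \<epsilon>"
  shows "n \<le> 2 ^ (28 * (K + 1) ^ 3)"
proof -
  obtain r b where split: "split_hopf_link n r b"
    and cube: "\<And>j. j \<in> {1..n} \<Longrightarrow> r j \<union> b j \<subseteq> {x. \<forall>i. 0 \<le> x$i \<and> x$i \<le> 1}"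
    and dist: "\<And>j. j \<in> {1..n} \<Longrightarrow> setdist (r j) (b j) \<ge> \<epsilon>"
    using assms(1) unfolding has_diagonal_embedding_def by blast
  have "\<exists>F. continuous_on UNIV F \<and> (\<forall>x. x \<notin> r j \<longrightarrow> F x \<noteq> 0) \<and> \<not> has_sqrt_on (b j) F"
    if "j \<in> {1..n}" for j
  proof -
    have "hopf_link (r j \<union> b j)" "smooth_circle (r j)" "smooth_circle (b j)" "r j \<inter> b j = {}"
      using split that unfolding split_hopf_link_def by auto
    then show ?thesis
      by (metis hopf_link_detecting_map)
  qed
  then obtain F where contF: "\<And>j. j \<in> {1..n} \<Longrightarrow> continuous_on UNIV (F j)"
    and nzF: "\<And>j x. j \<in> {1..n} \<Longrightarrow> x \<notin> r j \<Longrightarrow> F j x \<noteq> 0"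
    and linked: "\<And>j. j \<in> {1..n} \<Longrightarrow> \<not> has_sqrt_on (b j) (F j)"
    by metis
  define G where "G = (UNIV :: 3 set) \<rightarrow>\<^sub>E {..K}"
  define N where "N j = {q \<in> G. grid_cell K q \<inter> b j \<noteq> {}}" for j
  \<comment> \<open>The distance condition enters here: a cell that meets \<open>b j\<close> has
    diameter at most \<open>3 / real K < \<epsilon>\<close> and cannot reach
    \<open>r j\<close>.\<close>
  have avoid: "x \<notin> r j" if j: "j \<in> {1..n}" and x: "x \<in> (\<Union>q\<in>N j. grid_cell K q)" for j x
  proof
    assume "x \<in> r j"
    obtain q y where q: "x \<in> grid_cell K q" "y \<in> grid_cell K q" "y \<in> b j"
      using x unfolding N_def by blast
    then have "dist x y < \<epsilon>"
      using dist_grid_cell_le[OF assms(2) q(1,2)] assms(3) by simp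
    then show False
      using setdist_le_dist[OF \<open>x \<in> r j\<close> q(3)] dist[OF j] by simp
  qed
  have "card {1..n} \<le> 2 ^ (card G + card {(p, q). p \<in> G \<and> q \<in> G \<and>
      (grid_cell K p :: (real^3) set) \<inter> grid_cell K q \<noteq> {}})"
  proof (rule card_le_if_sqrt_dual[where N = N and b = b and F = F])
    show "finite G"
      by (simp add: G_def finite_PiE)
    show "convex (grid_cell K q :: (real^3) set)" "closed (grid_cell K q :: (real^3) set)" for q
      by (auto simp: grid_cell_def)
    show "N j \<subseteq> G" for j
      by (auto simp: N_def)
    show "b j \<subseteq> (\<Union>q\<in>N j. grid_cell K q)" if "j \<in> {1..n}" for j
    proof
      fix x assume "x \<in> b j"
      then have "\<forall>i. 0 \<le> x$i \<and> x$i \<le> 1"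
        using cube that by blast
      then obtain q where "q \<in> G" "x \<in> grid_cell K q"
        using grid_cells_cover_unit_cube[OF assms(2)] unfolding G_def by blast
      then show "x \<in> (\<Union>q\<in>N j. grid_cell K q)"
        using \<open>x \<in> b j\<close> by (auto simp: N_def)
    qed
    show "continuous_on (\<Union>q\<in>N j. grid_cell K q) (F j)" if "j \<in> {1..n}" for j
      using contF[OF that] continuous_on_subset by blast
    show "F j x \<noteq> 0" if "j \<in> {1..n}" "x \<in> (\<Union>q\<in>N j. grid_cell K q)" for j x
      using avoid nzF that by blast
    \<comment> \<open>The sphere for \<open>j\<close> keeps \<open>r j\<close> in \<open>U\<close>,
      so \<open>F j\<close> has no zeros on \<open>V \<union> S\<close>, while \<open>b i\<close>
      lies in \<open>V\<close>.\<close>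
    show "has_sqrt_on (b i) (F j)" if ij: "i \<in> {1..n}" "j \<in> {1..n}" "i \<noteq> j" for i j
    proof -
      obtain S where "sphere_separates S (r j \<union> b j) (\<Union>i\<in>{1..n} - {j}. r i \<union> b i)"
        using split ij(2) unfolding split_hopf_link_def by blast
      then obtain U V where S: "smooth_2sphere S" and UV: "U \<in> components (- S)"
        "V \<in> components (- S)" "U \<noteq> V" "r j \<union> b j \<subseteq> U" "(\<Union>i\<in>{1..n} - {j}. r i \<union> b i) \<subseteq> V"
        unfolding sphere_separates_def by blast
      have "U \<inter> V = {}"
        using UV components_nonoverlap by blast
      moreover have "U \<inter> S = {}"
        using UV(1) in_components_subset by blast
      ultimately have "x \<notin> r j" if "x \<in> V \<union> S" for x
        using UV(4) that by blast
      then have "has_sqrt_on V (F j)"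
        using nzF[OF ij(2)]
        by (intro has_sqrt_on_component_of_sphere_complement[OF smooth_2sphere_homeomorphic[OF S] _ UV(2)]
            continuous_on_subset[OF contF[OF ij(2)]]) auto
      moreover have "b i \<subseteq> V"
        using UV(5) ij by blast
      ultimately show ?thesis
        using has_sqrt_on_subset by blast
    qed
  qed (use linked in auto)
  \<comment> \<open>28 = 1 + 27: one bit per cell for membership in \<open>N j\<close>, and at most
    \<open>3 ^ 3\<close> bits per cell for the sign changes.\<close>
  also have "\<dots> \<le> 2 ^ (28 * (K + 1) ^ 3)"
    using card_adjacent_grid_cells[OF assms(2), where 'n = 3] card_grid[where 'n = 3, of K]
    by (intro power_increasing) (simp_all add: G_def)
  finally show ?thesis by simp
qed

theorem theorem1:
  shows "\<exists>a>0. \<exists>C>0. \<exists>\<epsilon>\<^sub>0>0. \<forall>\<epsilon>::real. 0 < \<epsilon> \<and> \<epsilon> < \<epsilon>\<^sub>0 \<longrightarrow>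
    (\<forall>n::nat. n \<ge> 1 \<longrightarrow> has_diagonal_embedding n \<epsilon> \<longrightarrow> real n \<le> C * exp (a * \<epsilon> powi (-3)))"
proof -
  \<comment> \<open>The witnesses are \<open>3500 * ln 2\<close>, 1 and 1. Here 3500 = 28 * 5^3,
    with 5 from \<open>real (K + 1) \<le> 5 / \<epsilon>\<close>, and \<open>ln 2\<close> changes
    the base from 2 to e.\<close>
  have "real n \<le> 1 * exp (3500 * ln 2 * \<epsilon> powi (-3))"
    if eps: "0 < \<epsilon>" "\<epsilon> < 1" and n: "has_diagonal_embedding n \<epsilon>" for \<epsilon> :: real and n
  proof -
    \<comment> \<open>Floor plus one lies strictly above \<open>3 / \<epsilon>\<close>, as the
      strict bound on the cell diameter requires.\<close>
    define K where "K = nat \<lfloor>3 / \<epsilon>\<rfloor> + 1"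
    have K: "3 / \<epsilon> < real K" "real K \<le> 3 / \<epsilon> + 1"
      using eps by (auto simp: K_def of_nat_nat) linarith
    moreover have "0 < real K"
      by (simp add: K_def)
    ultimately have "3 / real K < \<epsilon>"
      using eps by (simp add: field_simps)
    then have "n \<le> 2 ^ (28 * (K + 1) ^ 3)"
      using diagonal_embedding_card_le[OF n] by (simp add: K_def)
    then have "real n \<le> 2 ^ (28 * (K + 1) ^ 3)"
      by (metis of_nat_le_iff of_nat_numeral of_nat_power)
    also have "\<dots> = exp (real (28 * (K + 1) ^ 3) * ln 2)"
      by (simp add: exp_of_nat_mult del: of_nat_mult of_nat_power)
    also have "\<dots> \<le> exp (3500 * ln 2 * \<epsilon> powi (-3))"
    proof -
      \<comment> \<open>This absorbs the 2 in \<open>real (K + 1) \<le> 3 / \<epsilon> + 2\<close>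
        into \<open>2 / \<epsilon>\<close>.\<close>
      have "1 < 1 / \<epsilon>"
        using eps by simp
      then have "real (K + 1) \<le> 5 / \<epsilon>"
        using K(2) by simp
      then have "real (K + 1) ^ 3 \<le> (5 / \<epsilon>) ^ 3"
        by (intro power_mono) auto
      also have "\<dots> = 125 * \<epsilon> powi (-3)"
        by (simp add: power_int_minus power_divide field_simps)
      finally have "28 * real (K + 1) ^ 3 * ln 2 \<le> 28 * (125 * \<epsilon> powi (-3)) * ln 2"
        by (intro mult_right_mono mult_left_mono) auto
      then show ?thesis
        by (simp add: mult_ac)
    qed
    finally show ?thesis by simp
  qed
  moreover have "(0::real) < 3500 * ln 2"
    by simp
  ultimately show ?thesis
    by (metis zero_less_one)
qed

end
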